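(* For every integer $m\ge 1$, $WAR(Pm(PP))=1$.
   Context: Scheduling setting: $n$ jobs $J_1,\dots,J_n$, $m$ identical machines $M_1,\dots,M_m$; job $J_j$ has processing time $p_j>0$ on every machine. $Pm(PP)$ is the preemptive problem: a schedule starts at time $0$, jobs may be interrupted and resumed (possibly on another machine), each job is processed on at most one machine at any time, each machine processes at most one job at any time. For a feasible schedule $S$, the load $L^S_i$ of $M_i$ is the time by which $M_i$ finishes all processing assigned to it, and $L(S)=(L^S_1,\dots,L^S_m)$. For $X\in\mathbb{R}^m$ let $\overleftarrow{X}$ be $X$ sorted in non-increasing order and $\sigma(X)$ the prefix-sum vector; $X\preceq_s Y$ means $\sigma(\overleftarrow{X})\le\sigma(\overleftarrow{Y})$ coordinatewise. For an instance $\mathcal{I}$ with feasible schedules $\mathcal{S}$ and $S\in\mathcal{S}$, $s(S)$ is the infimum of $\alpha$ with $L(S)\preceq_s\alpha L(T)$ for all $T\in\mathcal{S}$, $s^*(\mathcal{I})=\inf_{S\in\mathcal{S}}s(S)$, and $WAR(\mathcal{P})=\sup_{\mathcal{I}}s^*(\mathcal{I})$ over all instances of problem $\mathcal{P}$ (with $m$ fixed). *)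

theory Defs
  imports Complex_Main "HOL-Library.Extended_Real"
begin

definition noninc_sort :: "real list \<Rightarrow> real list" where
  "noninc_sort X = rev (sort X)"

definition prefix_sums :: "real list \<Rightarrow> real list" where
  "prefix_sums X = map (\<lambda>k. sum_list (take (Suc k) X)) [0..<length X]"

definition sle :: "real list \<Rightarrow> real list \<Rightarrow> bool"  (infix "\<preceq>\<^sub>s" 50) where
  "X \<preceq>\<^sub>s Y \<longleftrightarrow>
     list_all2 (\<le>) (prefix_sums (noninc_sort X)) (prefix_sums (noninc_sort Y))"

text \<open>
  A problem is given by its instances \<open>Inst\<close>, the feasible schedules \<open>Feas I\<close> of each
  instance \<open>I\<close>, and the load vector \<open>L S\<close> of a schedule. Infima and suprema are taken in the
  extended reals, so that they are the genuine ones also for empty or unbounded sets.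
\<close>

definition s_ratio :: "('s \<Rightarrow> real list) \<Rightarrow> 's set \<Rightarrow> 's \<Rightarrow> ereal" where
  "s_ratio L F S = Inf {ereal \<alpha> | \<alpha>. \<forall>T\<in>F. L S \<preceq>\<^sub>s map (\<lambda>x. \<alpha> * x) (L T)}"

definition s_star :: "('s \<Rightarrow> real list) \<Rightarrow> 's set \<Rightarrow> ereal" where
  "s_star L F = (INF S\<in>F. s_ratio L F S)"

definition WAR :: "'i set \<Rightarrow> ('i \<Rightarrow> 's set) \<Rightarrow> ('s \<Rightarrow> real list) \<Rightarrow> ereal" where
  "WAR Inst Feas L = (SUP I\<in>Inst. s_star L (Feas I))"

text \<open>
  An instance is the nonempty list of the processing times; jobs and machines are numbered
  from \<open>0\<close>. A preemptive schedule is a finite set of pieces: in \<open>Piece j i a b\<close>, job \<open>j\<close> is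
  processed without interruption on machine \<open>i\<close> during \<open>[a, b)\<close>.
\<close>

datatype piece = Piece (job: nat) (machine: nat) (start: real) (finish: real)

definition instances :: "real list set" where
  "instances = {p. p \<noteq> [] \<and> (\<forall>x\<in>set p. 0 < x)}"

definition PP_schedules :: "nat \<Rightarrow> real list \<Rightarrow> piece set set" where
  "PP_schedules m p = {S. finite S \<and>
     (\<forall>q\<in>S. job q < length p \<and> machine q < m \<and> 0 \<le> start q \<and> start q < finish q) \<and>
     (\<forall>q\<in>S. \<forall>r\<in>S. q \<noteq> r \<and> (machine q = machine r \<or> job q = job r) \<longrightarrow>
        {start q..<finish q} \<inter> {start r..<finish r} = {}) \<and>
     (\<forall>j<length p. (\<Sum>q\<in>{q\<in>S. job q = j}. finish q - start q) = p ! j)}"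

text \<open>The load is a finishing time, so it includes idle time; an unused machine has load \<open>0\<close>.\<close>

definition load :: "piece set \<Rightarrow> nat \<Rightarrow> real" where
  "load S i = Max (insert 0 (finish ` {q\<in>S. machine q = i}))"

definition loads :: "nat \<Rightarrow> piece set \<Rightarrow> real list" where
  "loads m S = map (load S) [0..<m]"

definition WAR_PP :: "nat \<Rightarrow> ereal" where
  "WAR_PP m = WAR instances (PP_schedules m) (loads m)"

end

theory Submission imports Defs "HOL-Library.Multiset"
begin

text \<open>
  The order \<open>\<preceq>\<^sub>s\<close> is weak majorization, so it suffices to compare the excesses
  \<open>\<Sum>\<^sub>i max 0 (L\<^sub>i - c)\<close> for every level \<open>c \<ge> 0\<close>. In any schedule a job is processed for at most
  \<open>c\<close> time units before \<open>c\<close>, so the excess is at least \<open>\<Sum>\<^sub>j max 0 (p\<^sub>j - c)\<close>; it is also at least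
  \<open>\<Sum>\<^sub>j p\<^sub>j - m c\<close>. One schedule attains the larger of both bounds for all \<open>c\<close> at once: as long as
  some job is longer than the average load, give it a machine of its own; then distribute the
  remaining jobs evenly over the remaining machines by McNaughton's wrap-around rule.
\<close>

section \<open>Weak majorization through excesses over a level\<close>

text \<open>Each of the first \<open>r\<close> entries satisfies
  \<open>x \<le> c + max 0 (x - c)\<close>, and the excesses of the other entries are
  nonnegative.\<close>

lemma sum_list_take_le_excess:
  fixes c :: real
  assumes "r \<le> length X"
  shows "sum_list (take r X) \<le> r * c + (\<Sum>x\<leftarrow>X. max 0 (x - c))"
  using assms
proof (induction X arbitrary: r)
  case Nil
  then show ?case by simp
next
  case (Cons x X)
  have nonneg: "0 \<le> (\<Sum>x\<leftarrow>X. max 0 (x - c))"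
    by (rule sum_list_nonneg) auto
  show ?case
  proof (cases r)
    case 0
    then show ?thesis using nonneg by simp
  next
    case (Suc r')
    then show ?thesis
      using Cons.IH[of r'] Cons.prems by (simp add: algebra_simps)
  qed
qed

text \<open>The equality case of the previous bound: when \<open>c\<close> separates the first
  \<open>r\<close> entries from the rest, both estimates in it are tight.\<close>

lemma sum_list_take_eq_excess:
  fixes c :: real
  assumes "r \<le> length Y" "\<forall>y\<in>set (take r Y). c \<le> y" "\<forall>y\<in>set (drop r Y). y \<le> c"
  shows "sum_list (take r Y) = r * c + (\<Sum>y\<leftarrow>Y. max 0 (y - c))"
proof -
  have "(\<Sum>y\<leftarrow>Y. max 0 (y - c)) =
      (\<Sum>y\<leftarrow>take r Y. max 0 (y - c)) + (\<Sum>y\<leftarrow>drop r Y. max 0 (y - c))"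
    by (metis append_take_drop_id map_append sum_list_append)
  also have "map (\<lambda>y. max 0 (y - c)) (take r Y) = map (\<lambda>y. y - c) (take r Y)"
    using assms(2) by (intro map_cong) auto
  also have "map (\<lambda>y. max 0 (y - c)) (drop r Y) = map (\<lambda>y. 0) (drop r Y)"
    using assms(3) by (intro map_cong) auto
  finally show ?thesis
    using assms(1) by (simp add: sum_list_subtractf sum_list_triv)
qed

text \<open>The sum of the \<open>r\<close> largest entries is the minimum over \<open>c\<close> of
  \<open>r * c\<close> plus the excess over \<open>c\<close>, so smaller excesses give smaller
  prefix sums. For \<open>Y\<close> the minimum is attained at one of its own entries; hence only
  levels in \<open>set Y\<close> are tested, and these are nonnegative when \<open>Y\<close>
  consists of loads.\<close>

lemma sleI_excess:
  assumes len: "length X = length Y"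
    and excess: "\<And>c. c \<in> set Y \<Longrightarrow> (\<Sum>x\<leftarrow>X. max 0 (x - c)) \<le> (\<Sum>y\<leftarrow>Y. max 0 (y - c))"
  shows "X \<preceq>\<^sub>s Y"
proof -
  have sort_inv: "(\<Sum>z\<leftarrow>noninc_sort Z. max 0 (z - c)) = (\<Sum>z\<leftarrow>Z. max 0 (z - c))" for Z c
    by (metis mset_map mset_rev mset_sort noninc_sort_def sum_mset_sum_list)
  have "sum_list (take (Suc k) (noninc_sort X)) \<le> sum_list (take (Suc k) (noninc_sort Y))"
    if k: "k < length Y" for k
  proof -
    define Y' where "Y' = noninc_sort Y"
    have len': "length Y' = length Y" "length (noninc_sort X) = length Y"
      using len by (auto simp: Y'_def noninc_sort_def)
    have desc: "Y' ! j \<le> Y' ! i" if "i \<le> j" "j < length Y'" for i j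
      using that sorted_rev_nth_mono[of Y' i j] by (simp add: Y'_def noninc_sort_def)
    \<comment> \<open>Index \<open>k\<close> is the last one in the prefix of length
      \<open>Suc k\<close>, so this level separates that prefix of \<open>Y'\<close> from the
      rest.\<close>
    define c where "c = Y' ! k"
    have c: "c \<in> set Y"
      using k len' nth_mem[of k Y'] by (simp add: c_def Y'_def noninc_sort_def)
    have "sum_list (take (Suc k) (noninc_sort X)) \<le> Suc k * c + (\<Sum>x\<leftarrow>X. max 0 (x - c))"
      using sum_list_take_le_excess[of "Suc k" "noninc_sort X" c] k len' by (simp add: sort_inv)
    also have "\<dots> \<le> Suc k * c + (\<Sum>y\<leftarrow>Y'. max 0 (y - c))"
      using excess[OF c] by (simp add: Y'_def sort_inv)
    also have "\<dots> = sum_list (take (Suc k) Y')"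
      using k len' by (intro sum_list_take_eq_excess[symmetric])
        (auto simp: in_set_conv_nth c_def intro!: desc)
    finally show ?thesis by (simp add: Y'_def)
  qed
  then show ?thesis
    using len by (auto simp: sle_def prefix_sums_def noninc_sort_def list_all2_conv_all_nth)
qed

lemma sle_imp_sum_list_le:
  assumes "X \<preceq>\<^sub>s Y" "X \<noteq> []"
  shows "sum_list X \<le> sum_list Y"
proof -
  have *: "list_all2 (\<le>) (prefix_sums (noninc_sort X)) (prefix_sums (noninc_sort Y))"
    using assms by (simp add: sle_def)
  have len: "length X = length Y"
    using list_all2_lengthD[OF *] by (simp add: prefix_sums_def noninc_sort_def)
  \<comment> \<open>The last prefix sum, at index \<open>length X - 1\<close>, covers the whole
    list.\<close>
  have "sum_list (take (length X) (noninc_sort X)) \<le> sum_list (take (length X) (noninc_sort Y))"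
    using list_all2_nthD[OF *, of "length X - 1"] assms(2) len
    by (cases "length Y") (auto simp: prefix_sums_def noninc_sort_def simp del: upt_Suc)
  moreover have "take (length X) (noninc_sort Z) = noninc_sort Z" if "length Z = length X" for Z
    using that by (simp add: noninc_sort_def)
  moreover have "sum_list (noninc_sort Z) = sum_list Z" for Z
    by (metis mset_rev mset_sort noninc_sort_def sum_mset_sum_list)
  ultimately show ?thesis using len by simp
qed

section \<open>Lower bounds on the excess of any schedule\<close>

lemma sum_length_disjoint_intervals:
  fixes s f :: "'a \<Rightarrow> real"
  assumes "finite Q" "a \<le> b"
    and "\<And>q. q \<in> Q \<Longrightarrow> a \<le> s q \<and> s q \<le> f q \<and> f q \<le> b"
    and "\<And>q r. q \<in> Q \<Longrightarrow> r \<in> Q \<Longrightarrow> q \<noteq> r \<Longrightarrow> {s q..<f q} \<inter> {s r..<f r} = {}"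
  shows "(\<Sum>q\<in>Q. f q - s q) \<le> b - a"
proof -
  \<comment> \<open>Empty intervals contribute nothing, but disjointness says nothing about their
    position, so the induction runs without them.\<close>
  define Q' where "Q' = {q\<in>Q. s q < f q}"
  have "finite Q'" using assms(1) by (simp add: Q'_def)
  moreover have "a \<le> s q \<and> s q < f q \<and> f q \<le> b" if "q \<in> Q'" for q
    using assms(3)[of q] that by (auto simp: Q'_def)
  moreover have "{s q..<f q} \<inter> {s r..<f r} = {}" if "q \<in> Q'" "r \<in> Q'" "q \<noteq> r" for q r
    using assms(4)[of q r] that by (auto simp: Q'_def)
  ultimately have "(\<Sum>q\<in>Q'. f q - s q) \<le> b - a"
    using assms(2)
  proof (induction Q' arbitrary: b rule: finite_ranking_induct[where f = f])
    case empty
    then show ?case by simp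
  next
    case (insert x Q)
    show ?case
    proof (cases "x \<in> Q")
      case True
      with insert show ?thesis by (simp add: insert_absorb)
    next
      case False
      have "f q \<le> s x" if q: "q \<in> Q" for q
      proof (rule ccontr)
        assume "\<not> f q \<le> s x"
        \<comment> \<open>As \<open>f q \<le> f x\<close> by the ranking, the later of the two
          starts lies in both intervals.\<close>
        then have "max (s q) (s x) \<in> {s q..<f q} \<inter> {s x..<f x}"
          using insert.prems(1)[of q] insert.prems(1)[of x] insert.hyps(2)[OF q] q by auto
        moreover have "{s q..<f q} \<inter> {s x..<f x} = {}"
          using insert.prems(2)[of q x] q False by auto
        ultimately show False by blast
      qed
      then have "(\<Sum>q\<in>Q. f q - s q) \<le> s x - a"
        using insert.prems by (intro insert.IH) auto
      then show ?thesis
        using insert.prems(1)[of x] insert.hyps(1) False by simp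
    qed
  qed
  moreover have "(\<Sum>q\<in>Q. f q - s q) = (\<Sum>q\<in>Q'. f q - s q)"
    using assms(1,3) by (intro sum.mono_neutral_right) (auto simp: Q'_def not_less intro: antisym)
  ultimately show ?thesis by simp
qed

text \<open>An arbitrary job set \<open>A\<close> replaces the index range of a list, so that a job
  can be removed in an induction without renumbering the others.\<close>

definition schedule :: "(nat \<Rightarrow> real) \<Rightarrow> nat set \<Rightarrow> nat \<Rightarrow> piece set \<Rightarrow> bool" where
  "schedule p A m S \<longleftrightarrow> finite S \<and>
     (\<forall>q\<in>S. job q \<in> A \<and> machine q < m \<and> 0 \<le> start q \<and> start q < finish q) \<and>
     (\<forall>q\<in>S. \<forall>r\<in>S. q \<noteq> r \<and> (machine q = machine r \<or> job q = job r) \<longrightarrow>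
        {start q..<finish q} \<inter> {start r..<finish r} = {}) \<and>
     (\<forall>j\<in>A. (\<Sum>q\<in>{q\<in>S. job q = j}. finish q - start q) = p j)"

lemma PP_schedules_iff: "S \<in> PP_schedules m p \<longleftrightarrow> schedule (\<lambda>j. p ! j) {..<length p} m S"
  by (auto simp: PP_schedules_def schedule_def)

lemma load_nonneg: "finite S \<Longrightarrow> 0 \<le> load S i"
  by (simp add: load_def)

lemma finish_le_load: "finite S \<Longrightarrow> q \<in> S \<Longrightarrow> finish q \<le> load S (machine q)"
  by (auto simp: load_def intro!: Max_ge)

lemma load_le:
  assumes "finite S" "0 \<le> b" "\<And>q. q \<in> S \<Longrightarrow> machine q = i \<Longrightarrow> finish q \<le> b"
  shows "load S i \<le> b"
  using assms by (auto simp: load_def)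

text \<open>Every piece is cut at time \<open>c\<close>. The parts of job \<open>j\<close> before
  \<open>c\<close> are disjoint and fit into \<open>[0, c)\<close>, so at least
  \<open>p j - c\<close> remains after \<open>c\<close>; summed by machine instead of by job, the
  parts after \<open>c\<close> fit between \<open>c\<close> and the load.\<close>

lemma excess_ge_jobs:
  assumes S: "schedule p A m S" and "finite A" "0 \<le> c"
  shows "(\<Sum>j\<in>A. max 0 (p j - c)) \<le> (\<Sum>i<m. max 0 (load S i - c))"
proof -
  have fin: "finite S" using S by (simp add: schedule_def)
  define before where "before q = min (finish q) c - min (start q) c" for q
  define after where "after q = max (finish q) c - max (start q) c" for q
  have split: "finish q - start q = before q + after q" for q
    by (auto simp: before_def after_def)
  have valid: "job q \<in> A" "machine q < m" "0 \<le> start q" "start q < finish q" if "q \<in> S" for q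
    using S that by (auto simp: schedule_def)
  have disj: "{start q..<finish q} \<inter> {start r..<finish r} = {}"
    if "q \<in> S" "r \<in> S" "q \<noteq> r" "machine q = machine r \<or> job q = job r" for q r
    using S that unfolding schedule_def by blast
  have "max 0 (p j - c) \<le> (\<Sum>q\<in>{q\<in>S. job q = j}. after q)" if j: "j \<in> A" for j
  proof -
    have "(\<Sum>q\<in>{q\<in>S. job q = j}. before q) \<le> c - 0"
      unfolding before_def
    proof (rule sum_length_disjoint_intervals)
      fix q r assume "q \<in> {q\<in>S. job q = j}" "r \<in> {q\<in>S. job q = j}" "q \<noteq> r"
      then have "{start q..<finish q} \<inter> {start r..<finish r} = {}" by (intro disj) auto
      moreover have "{min (start q) c..<min (finish q) c} \<subseteq> {start q..<finish q}" for q by auto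
      ultimately show
        "{min (start q) c..<min (finish q) c} \<inter> {min (start r) c..<min (finish r) c} = {}"
        by blast
    qed (use fin valid \<open>0 \<le> c\<close> in \<open>force simp: min_def\<close>)+
    moreover have "p j = (\<Sum>q\<in>{q\<in>S. job q = j}. before q + after q)"
      using S j by (simp add: schedule_def split)
    moreover have "0 \<le> (\<Sum>q\<in>{q\<in>S. job q = j}. after q)"
      using valid(4) by (intro sum_nonneg) (force simp: after_def)
    ultimately show ?thesis by (simp add: sum.distrib)
  qed
  then have "(\<Sum>j\<in>A. max 0 (p j - c)) \<le> (\<Sum>j\<in>A. \<Sum>q\<in>{q\<in>S. job q = j}. after q)"
    by (intro sum_mono)
  also have "\<dots> = (\<Sum>q\<in>S. after q)"
    using fin \<open>finite A\<close> valid by (intro sum.group) auto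
  also have "\<dots> = (\<Sum>i<m. \<Sum>q\<in>{q\<in>S. machine q = i}. after q)"
    using fin valid by (intro sum.group[symmetric]) auto
  also have "\<dots> \<le> (\<Sum>i<m. max 0 (load S i - c))"
  proof (rule sum_mono)
    fix i
    \<comment> \<open>The right end is \<open>max c (load S i)\<close> because the machine may
      finish before \<open>c\<close>.\<close>
    have "(\<Sum>q\<in>{q\<in>S. machine q = i}. after q) \<le> max c (load S i) - c"
      unfolding after_def
    proof (rule sum_length_disjoint_intervals)
      fix q r assume "q \<in> {q\<in>S. machine q = i}" "r \<in> {q\<in>S. machine q = i}" "q \<noteq> r"
      then have "{start q..<finish q} \<inter> {start r..<finish r} = {}" by (intro disj) auto
      moreover have "{max (start q) c..<max (finish q) c} \<subseteq> {start q..<finish q}" for q by auto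
      ultimately show
        "{max (start q) c..<max (finish q) c} \<inter> {max (start r) c..<max (finish r) c} = {}"
        by blast
    next
      fix q assume "q \<in> {q\<in>S. machine q = i}"
      then show "c \<le> max (start q) c \<and> max (start q) c \<le> max (finish q) c \<and>
          max (finish q) c \<le> max c (load S i)"
        using finish_le_load[OF fin, of q] valid(4)[of q] by auto
    qed (use fin in auto)
    then show "(\<Sum>q\<in>{q\<in>S. machine q = i}. after q) \<le> max 0 (load S i - c)" by simp
  qed
  finally show ?thesis .
qed

lemma sum_jobs_le_sum_loads:
  assumes S: "schedule p A m S" and "finite A" and pos: "\<And>j. j \<in> A \<Longrightarrow> 0 \<le> p j"
  shows "sum p A \<le> (\<Sum>i<m. load S i)"
proof -
  have "finite S" using S by (simp add: schedule_def)
  with excess_ge_jobs[OF S \<open>finite A\<close>, of 0] pos show ?thesis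
    by (simp add: load_nonneg max_def)
qed

lemma excess_ge_total:
  fixes c :: real
  assumes "schedule p A m S" "finite A" "\<And>j. j \<in> A \<Longrightarrow> 0 \<le> p j"
  shows "sum p A - m * c \<le> (\<Sum>i<m. max 0 (load S i - c))"
proof -
  have "sum p A - m * c \<le> (\<Sum>i<m. load S i - c)"
    using sum_jobs_le_sum_loads[OF assms] by (simp add: sum_subtractf)
  also have "\<dots> \<le> (\<Sum>i<m. max 0 (load S i - c))"
    by (intro sum_mono) simp
  finally show ?thesis .
qed

section \<open>McNaughton's wrap-around rule\<close>

lemma mcnaughton:
  fixes p :: "nat \<Rightarrow> real"
  assumes "finite A" and pos: "\<And>j. j \<in> A \<Longrightarrow> 0 < p j" and le: "\<And>j. j \<in> A \<Longrightarrow> p j \<le> D"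
    and total: "sum p A = m * D" and D: "0 \<le> D"
  obtains S where "schedule p A m S" "\<And>i. load S i \<le> D"
proof -
  \<comment> \<open>The jobs are laid out consecutively on \<open>[0, m D)\<close>, job \<open>j\<close> starting at \<open>off j\<close>; machine \<open>i\<close>
    executes the segment \<open>[i D, (i + 1) D)\<close>, shifted to time \<open>0\<close>.\<close>
  define off where "off j = sum p {k\<in>A. k < j}" for j
  \<comment> \<open>\<open>clip j x\<close> is the point of job \<open>j\<close>'s interval on the
    line nearest to \<open>x\<close>; the share of job \<open>j\<close> in segment \<open>i\<close>
    lies between the clipped segment ends. The set \<open>I\<close> below keeps the nonempty
    shares.\<close>
  define clip where "clip j x = max (off j) (min (off j + p j) x)" for j x
  define pc where
    "pc = (\<lambda>(j, i). Piece j i (clip j (real i * D) - i * D) (clip j (real (Suc i) * D) - i * D))"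
  define I where "I = {(j, i). j \<in> A \<and> i < m \<and> clip j (real i * D) < clip j (real (Suc i) * D)}"
  define S where "S = pc ` I"
  have finI: "finite I"
    by (rule finite_subset[of _ "A \<times> {..<m}"]) (use \<open>finite A\<close> in \<open>auto simp: I_def\<close>)
  have inj: "inj_on pc I" by (auto simp: inj_on_def pc_def)
  have off_nonneg: "0 \<le> off j" for j
    unfolding off_def by (intro sum_nonneg) (use pos in force)
  have off_Suc: "off j + p j = sum p {k\<in>A. k \<le> j}" if "j \<in> A" for j
  proof -
    have "{k\<in>A. k \<le> j} = insert j {k\<in>A. k < j}" using that by auto
    then show ?thesis using \<open>finite A\<close> by (simp add: off_def)
  qed
  have off_mono: "off j + p j \<le> off k" if "j \<in> A" "j < k" for j k
    unfolding off_Suc[OF that(1)] unfolding off_def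
    by (intro sum_mono2) (use \<open>finite A\<close> that pos in \<open>force\<close>)+
  have off_le: "off j + p j \<le> m * D" if "j \<in> A" for j
    unfolding off_Suc[OF that] total[symmetric]
    by (intro sum_mono2) (use \<open>finite A\<close> pos in \<open>force\<close>)+
  have SucD: "real (Suc i) * D = i * D + D" for i by (simp add: algebra_simps)
  \<comment> \<open>Time \<open>x\<close> on machine \<open>i\<close> is position
    \<open>x + i * D\<close> on the line. All conflicts are decided by comparing such
    positions.\<close>
  have window: "off j \<le> x + i * D \<and> x + i * D < off j + p j \<and> 0 \<le> x \<and> x < D"
    if ji: "(j, i) \<in> I" and x: "x \<in> {start (pc (j, i))..<finish (pc (j, i))}" for j i x
  proof -
    have "0 < p j" "clip j (i * D) < clip j (i * D + D)" using ji pos SucD by (auto simp: I_def)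
    then show ?thesis using x
      by (auto simp: pc_def clip_def SucD max_def min_def simp del: of_nat_Suc split: if_splits)
  qed
  have "schedule p A m S"
    unfolding schedule_def
  proof (intro conjI ballI impI)
    show "finite S" using finI by (simp add: S_def)
  next
    fix q assume "q \<in> S"
    then obtain j i where q: "q = pc (j, i)" "(j, i) \<in> I" by (auto simp: S_def)
    have "start q < finish q" using q by (auto simp: pc_def I_def)
    then have "start q \<in> {start (pc (j, i))..<finish (pc (j, i))}" using q by simp
    from window[OF q(2) this] \<open>start q < finish q\<close> q
    show "job q \<in> A" "machine q < m" "0 \<le> start q" "start q < finish q"
      by (auto simp: pc_def I_def)
  next
    fix q r assume "q \<in> S" "r \<in> S" and qr: "q \<noteq> r \<and> (machine q = machine r \<or> job q = job r)"
    then obtain j i k l where q: "q = pc (j, i)" "(j, i) \<in> I" and r: "r = pc (k, l)" "(k, l) \<in> I"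
      by (auto simp: S_def)
    have A: "j \<in> A" "k \<in> A" using q r by (auto simp: I_def)
    have False if "x \<in> {start q..<finish q}" "x \<in> {start r..<finish r}" for x
    proof -
      note wq = window[OF q(2) that(1)[unfolded q(1)]]
      note wr = window[OF r(2) that(2)[unfolded r(1)]]
      \<comment> \<open>On a common machine, equal times are equal positions, but distinct jobs
        occupy disjoint intervals. For a common job, equal times on distinct machines are positions
        at least \<open>D\<close> apart, too far for a half-open interval of length
        \<open>p j \<le> D\<close>.\<close>
      from qr q r consider "i = l" "j < k" | "i = l" "k < j" | "j = k" "i < l" | "j = k" "l < i"
        by (fastforce simp: pc_def)
      then show False
      proof cases
        case 1 then show ?thesis using wq wr off_mono[of j k] A by force
      next
        case 2 then show ?thesis using wq wr off_mono[of k j] A by force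
      next
        case 3
        then have "real (Suc i) * D \<le> l * D" using D by (intro mult_right_mono) auto
        then show ?thesis using wq wr le[OF A(1)] 3 unfolding SucD by auto
      next
        case 4
        then have "real (Suc l) * D \<le> i * D" using D by (intro mult_right_mono) auto
        then show ?thesis using wq wr le[OF A(1)] 4 unfolding SucD by auto
      qed
    qed
    then show "{start q..<finish q} \<inter> {start r..<finish r} = {}" by blast
  next
    fix j assume j: "j \<in> A"
    have mono: "clip j (i * D) \<le> clip j (real (Suc i) * D)" for i
      unfolding SucD using D by (auto simp: clip_def)
    define J where "J = {i. i < m \<and> clip j (real i * D) < clip j (real (Suc i) * D)}"
    have "{q\<in>S. job q = j} = (\<lambda>i. pc (j, i)) ` J"
      using j by (auto simp: S_def I_def J_def pc_def)
    moreover have "inj_on (\<lambda>i. pc (j, i)) J" by (auto simp: inj_on_def pc_def)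
    ultimately have "(\<Sum>q\<in>{q\<in>S. job q = j}. finish q - start q)
        = (\<Sum>i\<in>J. clip j (real (Suc i) * D) - clip j (real i * D))"
      by (simp add: sum.reindex pc_def)
    \<comment> \<open>Machines without a share of job \<open>j\<close> add zero, so the sum can run
      over all machines and telescopes; the job's interval lies within \<open>[0, m D)\<close>, so
      its full length results.\<close>
    also have "\<dots> = (\<Sum>i<m. clip j (real (Suc i) * D) - clip j (real i * D))"
      by (intro sum.mono_neutral_left)
        (use mono in \<open>auto simp del: of_nat_Suc simp: J_def not_less intro: antisym\<close>)
    also have "\<dots> = clip j (m * D) - clip j 0"
      using sum_lessThan_telescope[of "\<lambda>i. clip j (real i * D)" m] by simp
    also have "\<dots> = p j"
      using off_nonneg[of j] off_le[OF j] pos[OF j] by (simp add: clip_def)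
    finally show "(\<Sum>q\<in>{q\<in>S. job q = j}. finish q - start q) = p j" .
  qed
  moreover have "load S i \<le> D" for i
  proof (rule load_le)
    show "finite S" using finI by (simp add: S_def)
  next
    fix q assume "q \<in> S"
    then obtain j i where q: "q = pc (j, i)" "(j, i) \<in> I" by (auto simp: S_def)
    show "finish q \<le> D"
    \<comment> \<open>\<open>window\<close> covers only times strictly before the finish, so the
      bound passes to the endpoint by density.\<close>
    proof (rule dense_le)
      fix x assume "x < finish q"
      have "start q < finish q" using q by (auto simp: pc_def I_def)
      then have "max x (start q) \<in> {start (pc (j, i))..<finish (pc (j, i))}"
        using q \<open>x < finish q\<close> by auto
      from window[OF q(2) this] show "x \<le> D" by simp
    qed
  qed (fact D)
  ultimately show thesis by (rule that)
qed

section \<open>A schedule attaining the lower bounds\<close>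

text \<open>The new piece shares neither machine nor job with any piece of \<open>S\<close>, so no
  conflict arises and the old loads persist.\<close>

lemma schedule_own_machine:
  assumes S: "schedule p (A - {j}) m S" and "finite A" "j \<in> A" "0 < p j"
  shows "schedule p A (Suc m) (insert (Piece j m 0 (p j)) S)"
    and "load (insert (Piece j m 0 (p j)) S) m = p j"
    and "i < m \<Longrightarrow> load (insert (Piece j m 0 (p j)) S) i = load S i"
proof -
  let ?n = "Piece j m 0 (p j)"
  have fin: "finite S" and valid: "\<And>q. q \<in> S \<Longrightarrow> job q \<in> A - {j} \<and> machine q < m"
    using S by (auto simp: schedule_def)
  have jobs: "{q \<in> insert ?n S. job q = k} = (if k = j then {?n} else {q\<in>S. job q = k})" for k
    using valid by auto
  have machines: "{q \<in> insert ?n S. machine q = k} =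
      (if k = m then {?n} else {q\<in>S. machine q = k})" for k
    using valid by auto
  show "schedule p A (Suc m) (insert ?n S)"
    unfolding schedule_def
  proof (intro conjI)
    show "\<forall>q\<in>insert ?n S. \<forall>r\<in>insert ?n S.
        q \<noteq> r \<and> (machine q = machine r \<or> job q = job r) \<longrightarrow>
        {start q..<finish q} \<inter> {start r..<finish r} = {}"
    proof (intro ballI impI)
      fix q r
      assume qr: "q \<in> insert ?n S" "r \<in> insert ?n S"
        "q \<noteq> r \<and> (machine q = machine r \<or> job q = job r)"
      then have "q \<in> S" "r \<in> S" using valid by fastforce+
      then show "{start q..<finish q} \<inter> {start r..<finish r} = {}"
        using S qr(3) unfolding schedule_def by blast
    qed
    show "\<forall>k\<in>A. (\<Sum>q\<in>{q \<in> insert ?n S. job q = k}. finish q - start q) = p k"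
      unfolding jobs using S by (auto simp: schedule_def)
  qed (use S assms in \<open>auto simp: schedule_def less_Suc_eq\<close>)
  show "load (insert ?n S) m = p j"
    unfolding load_def machines using \<open>0 < p j\<close> by simp
  show "load (insert ?n S) i = load S i" if "i < m"
    unfolding load_def machines using that by simp
qed

text \<open>The schedule is chosen before the level \<open>c\<close>, and its excess is bounded by
  the larger of the two lower bounds. If no job exceeds the average load, all loads are at most that
  average; otherwise a longer job takes the last machine and the induction on \<open>m\<close>
  handles the rest.\<close>

lemma optimal_schedule_exists:
  fixes p :: "nat \<Rightarrow> real"
  assumes "1 \<le> m" "finite A" "\<And>j. j \<in> A \<Longrightarrow> 0 < p j"
  shows "\<exists>S. schedule p A m S \<and> (\<forall>c::real. (\<Sum>i<m. max 0 (load S i - c)) \<le>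
    max (\<Sum>j\<in>A. max 0 (p j - c)) (sum p A - m * c))"
  using assms
proof (induction m arbitrary: A rule: nat_induct_at_least)
  have balanced: "\<exists>S. schedule p A m S \<and> (\<forall>c::real. (\<Sum>i<m. max 0 (load S i - c)) \<le>
      max (\<Sum>j\<in>A. max 0 (p j - c)) (sum p A - m * c))"
    if "1 \<le> m" "finite A" and pos: "\<And>j. j \<in> A \<Longrightarrow> 0 < p j"
      and le: "\<And>j. j \<in> A \<Longrightarrow> m * p j \<le> sum p A" for m A
  proof -
    define D where "D = sum p A / m"
    have D: "0 \<le> D" "sum p A = m * D"
      using \<open>1 \<le> m\<close> sum_nonneg[of A p] pos by (auto simp: D_def less_imp_le)
    moreover have "p j \<le> D" if "j \<in> A" for j
      using le[OF that] \<open>1 \<le> m\<close> by (simp add: D_def field_simps)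
    ultimately obtain S where S: "schedule p A m S" "\<And>i. load S i \<le> D"
      using mcnaughton[of A p D m] \<open>finite A\<close> pos by blast
    have "(\<Sum>i<m. max 0 (load S i - c)) \<le>
        max (\<Sum>j\<in>A. max 0 (p j - c)) (sum p A - m * c)" for c :: real
    proof -
      have "(\<Sum>i<m. max 0 (load S i - c)) \<le> (\<Sum>i<m. max 0 (D - c))"
        using S(2) by (intro sum_mono max.mono) auto
      also have "\<dots> = max 0 (sum p A - m * c)"
        using D(2) by (simp add: max_mult_distrib_left right_diff_distrib)
      also have "\<dots> \<le> max (\<Sum>j\<in>A. max 0 (p j - c)) (sum p A - m * c)"
        by (intro max.mono sum_nonneg) auto
      finally show ?thesis .
    qed
    with S(1) show ?thesis by blast
  qed
  {
    case base
    \<comment> \<open>On a single machine the average load is the total, which no job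
      exceeds.\<close>
    then have "p j \<le> sum p A" if "j \<in> A" for j
      using that by (intro member_le_sum) (auto intro: less_imp_le)
    with base show ?case by (intro balanced) auto
  next
    case (Suc m)
    show ?case
    proof (cases "\<forall>j\<in>A. Suc m * p j \<le> sum p A")
      case True
      with Suc.prems show ?thesis by (intro balanced) auto
    next
      case False
      then obtain j where j: "j \<in> A" and large: "sum p A < Suc m * p j" by (auto simp: not_le)
      obtain S where S: "schedule p (A - {j}) m S" and excess:
        "\<And>c::real. (\<Sum>i<m. max 0 (load S i - c)) \<le>
          max (\<Sum>k\<in>A - {j}. max 0 (p k - c)) (sum p (A - {j}) - m * c)"
        using Suc.IH[of "A - {j}"] Suc.prems by auto
      let ?S = "insert (Piece j m 0 (p j)) S"
      note own = schedule_own_machine[OF S Suc.prems(1) j Suc.prems(2)[OF j]]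
      have "(\<Sum>i<Suc m. max 0 (load ?S i - c)) \<le>
          max (\<Sum>k\<in>A. max 0 (p k - c)) (sum p A - Suc m * c)" for c :: real
      proof -
        have jobs: "(\<Sum>k\<in>A. max 0 (p k - c)) =
            max 0 (p j - c) + (\<Sum>k\<in>A - {j}. max 0 (p k - c))"
          and total: "sum p A = p j + sum p (A - {j})"
          using Suc.prems(1) j by (auto intro: sum.remove)
        have nonneg: "0 \<le> (\<Sum>k\<in>A - {j}. max 0 (p k - c))" by (intro sum_nonneg) auto
        \<comment> \<open>For \<open>c < p j\<close> the new machine adds exactly
          \<open>p j - c\<close> to the excess and to both bounds. For \<open>c \<ge> p j\<close> it
          adds nothing; the remaining jobs total less than \<open>m * p j\<close>, so their average
          bound is at most zero and the nonnegative job bound dominates.\<close>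
        have "sum p (A - {j}) - m * c \<le> 0" if "p j \<le> c"
        proof -
          have "m * p j \<le> m * c" using that by (intro mult_left_mono) auto
          then show ?thesis using large total by (simp add: algebra_simps)
        qed
        moreover have "(\<Sum>i<Suc m. max 0 (load ?S i - c)) =
            max 0 (p j - c) + (\<Sum>i<m. max 0 (load S i - c))"
          using own(2,3) by simp
        ultimately show ?thesis
          using excess[of c] jobs total nonneg by (auto simp: algebra_simps max_def split: if_splits)
      qed
      with own(1) show ?thesis by blast
    qed
  }
qed

section \<open>The ratio of every instance\<close>

lemma sum_list_loads: "(\<Sum>x\<leftarrow>loads m S. g x) = (\<Sum>i<m. g (load S i))"
  by (simp add: loads_def comp_def sum_list_sum_nth atLeast0LessThan)

lemma s_star_PP:
  assumes "1 \<le> m" "p \<in> instances"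
  shows "s_star (loads m) (PP_schedules m p) = 1"
proof (rule antisym)
  have pos: "0 < p ! j" if "j \<in> {..<length p}" for j
    using assms(2) that by (auto simp: instances_def)
  obtain S where S: "S \<in> PP_schedules m p" and excess:
    "\<And>c::real. (\<Sum>i<m. max 0 (load S i - c)) \<le>
      max (\<Sum>j<length p. max 0 (p ! j - c)) ((\<Sum>j<length p. p ! j) - m * c)"
    using optimal_schedule_exists[of m "{..<length p}" "\<lambda>j. p ! j"] assms(1) pos
    by (auto simp: PP_schedules_iff)
  have "loads m S \<preceq>\<^sub>s map (\<lambda>x. 1 * x) (loads m T)" if T: "T \<in> PP_schedules m p" for T
  proof (rule sleI_excess)
    fix c assume "c \<in> set (map (\<lambda>x. 1 * x) (loads m T))"
    \<comment> \<open>Nonnegativity of the level is what \<open>excess_ge_jobs\<close>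
      requires.\<close>
    then have "0 \<le> c"
      using T by (auto simp: loads_def PP_schedules_def intro: load_nonneg)
    with T[unfolded PP_schedules_iff] pos have
      "max (\<Sum>j<length p. max 0 (p ! j - c)) ((\<Sum>j<length p. p ! j) - m * c)
        \<le> (\<Sum>i<m. max 0 (load T i - c))"
      by (intro max.boundedI excess_ge_jobs excess_ge_total) (auto intro: less_imp_le)
    from order_trans[OF excess this] show "(\<Sum>x\<leftarrow>loads m S. max 0 (x - c)) \<le>
        (\<Sum>y\<leftarrow>map (\<lambda>x. 1 * x) (loads m T). max 0 (y - c))"
      by (simp add: sum_list_loads)
  qed (simp add: loads_def)
  then have "s_ratio (loads m) (PP_schedules m p) S \<le> 1"
    unfolding s_ratio_def one_ereal_def by (intro Inf_lower) blast
  with S show "s_star (loads m) (PP_schedules m p) \<le> 1"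
    unfolding s_star_def by (rule INF_lower2)
  show "1 \<le> s_star (loads m) (PP_schedules m p)"
    unfolding s_star_def s_ratio_def
  proof (intro INF_greatest Inf_greatest)
    fix S z
    assume S: "S \<in> PP_schedules m p" and "z \<in> {ereal \<alpha> |\<alpha>. \<forall>T\<in>PP_schedules m p.
      loads m S \<preceq>\<^sub>s map (\<lambda>x. \<alpha> * x) (loads m T)}"
    \<comment> \<open>Comparing \<open>S\<close> with itself suffices: its total load is positive,
      so the last prefix sum forces \<open>\<alpha> \<ge> 1\<close>.\<close>
    then obtain \<alpha> where \<alpha>: "z = ereal \<alpha>" "loads m S \<preceq>\<^sub>s map (\<lambda>x. \<alpha> * x) (loads m S)" by blast
    have "0 < (\<Sum>j<length p. p ! j)"
      using assms(2) pos by (intro sum_pos) (auto simp: instances_def)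
    also have "\<dots> \<le> (\<Sum>i<m. load S i)"
      using S pos by (intro sum_jobs_le_sum_loads) (auto simp: PP_schedules_iff intro: less_imp_le)
    also have "\<dots> = sum_list (loads m S)"
      using sum_list_loads[of "\<lambda>x. x"] by simp
    finally have "0 < sum_list (loads m S)" .
    moreover have "sum_list (loads m S) \<le> \<alpha> * sum_list (loads m S)"
      using sle_imp_sum_list_le[OF \<alpha>(2)] assms(1)
      by (simp add: loads_def sum_list_const_mult comp_def)
    ultimately have "1 \<le> \<alpha>" by simp
    then show "1 \<le> z" using \<alpha>(1) by simp
  qed
qed

theorem theorem4:
  fixes m :: nat
  assumes "m \<ge> 1"
  shows "WAR_PP m = 1"
proof -
  \<comment> \<open>A supremum of the constant 1 equals 1 only over a nonempty set; over the empty
    set it would be minus infinity.\<close>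
  have "[1] \<in> instances" by (simp add: instances_def)
  then have "instances \<noteq> {}" by blast
  then show ?thesis
    using s_star_PP[OF assms] by (simp add: WAR_PP_def WAR_def)
qed

end
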